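(* For every $\alpha\in(0,1]$ and every real $x\neq 0$, the mapping $$\beta\mapsto \Gamma(\beta)\,E_{\alpha,\beta}\!\left(\frac{\Gamma(\beta+\alpha)}{\Gamma(\beta)}\,x\right)$$ is increasing on $(\alpha,\infty)$. Moreover, as $\beta\to\infty$ it converges to $\infty$ if $x\ge 1$ and to $1/(1-x)$ if $x<1$.
   Context: For $\alpha,\beta>0$, $E_{\alpha,\beta}$ denotes the two-parameter Mittag-Leffler function $E_{\alpha,\beta}(z)=\sum_{n\ge 0}\frac{z^n}{\Gamma(\beta+\alpha n)}$, where $\Gamma$ is the Gamma function. *)

theory Defs
  imports "HOL-Analysis.Analysis"
begin

definition mittag_leffler :: "real \<Rightarrow> real \<Rightarrow> real \<Rightarrow> real" where
  "mittag_leffler \<alpha> \<beta> z = (\<Sum>n. z ^ n / Gamma (\<beta> + \<alpha> * real n))"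

end

theory Submission
  imports Defs "HOL-Real_Asymp.Real_Asymp"
begin

text \<open>Write \<open>f \<beta> x\<close> for the mapping and \<open>E\<^bsub>\<alpha>,\<beta>\<^esub>\<close> for the Mittag-Leffler function. For \<open>\<gamma> > \<beta>\<close> a Beta
  integral expresses \<open>\<Gamma>(\<gamma>) E\<^bsub>\<alpha>,\<gamma>\<^esub>(z)\<close> as the mean of \<open>\<Gamma>(\<beta>) E\<^bsub>\<alpha>,\<beta>\<^esub>(z u powr \<alpha>)\<close> for \<open>u\<close> distributed as
  Beta(\<open>\<beta>\<close>, \<open>\<gamma> - \<beta>\<close>), and the factor \<open>\<Gamma>(\<beta> + \<alpha>) / \<Gamma>(\<beta>)\<close> is exactly what makes the means of the arguments
  agree. So monotonicity in \<open>\<beta>\<close> is Jensen's inequality, once \<open>E\<^bsub>\<alpha>,\<beta>\<^esub>\<close> is strictly convex on the real line.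
  For negative arguments, its second derivative is a repeated Beta convolution of \<open>E\<^bsub>\<alpha>,\<alpha>\<^esub>\<close> with itself and with
  a positive constant, and \<open>E\<^bsub>\<alpha>,\<alpha>\<^esub> > 0\<close> there because it is the resolvent of a log-convex Volterra kernel.

  For \<open>x > 0\<close> the limit is taken termwise. For \<open>x < 0\<close> it comes from the recursion
  \<open>f \<beta> x = 1 + x * f (\<beta> + \<alpha>) (\<rho> * x)\<close> with \<open>\<rho> \<longlongrightarrow> 1\<close>, whose limiting form \<open>L = 1 + x * L\<close> has the solution \<open>1 / (1 - x)\<close>.\<close>

subsection \<open>Mittag-Leffler series and Beta convolution\<close>

text \<open>The coefficients \<open>a\<close> stay free so that differentiation and Beta convolution
  do not leave the family: constant 1 gives the Mittag-Leffler function, \<open>Suc n\<close> a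
  three-parameter (Prabhakar) function, and a sequence supported at 0 a constant.\<close>

definition ml_series :: "(nat \<Rightarrow> real) \<Rightarrow> real \<Rightarrow> real \<Rightarrow> real \<Rightarrow> real" where
  "ml_series a \<alpha> p x = (\<Sum>n. a n * x ^ n / Gamma (p + \<alpha> * real n))"

definition ml_entire :: "(nat \<Rightarrow> real) \<Rightarrow> real \<Rightarrow> real \<Rightarrow> bool" where
  "ml_entire a \<alpha> p \<longleftrightarrow> (\<forall>x. summable (\<lambda>n. a n * x ^ n / Gamma (p + \<alpha> * real n)))"

definition cauchy_prod :: "(nat \<Rightarrow> real) \<Rightarrow> (nat \<Rightarrow> real) \<Rightarrow> nat \<Rightarrow> real" where
  "cauchy_prod a b k = (\<Sum>i\<le>k. a i * b (k - i))"

text \<open>A power series that converges at |x| + 1 converges absolutely at x.\<close>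

lemma ml_entire_abs:
  assumes "ml_entire a \<alpha> p"
  shows "summable (\<lambda>n. \<bar>a n * x ^ n / Gamma (p + \<alpha> * real n)\<bar>)"
proof -
  have "summable (\<lambda>n. (a n / Gamma (p + \<alpha> * real n)) * (\<bar>x\<bar> + 1) ^ n)"
    using assms unfolding ml_entire_def by (auto dest: spec[of _ "\<bar>x\<bar> + 1"])
  then have "summable (\<lambda>n. norm ((a n / Gamma (p + \<alpha> * real n)) * x ^ n))"
    by (rule powser_insidea) auto
  then show ?thesis by simp
qed

section \<open>Gamma inequalities from log-convexity, and convergence of the series\<close>

lemma Gamma_slope_le:
  fixes s t u :: real
  assumes "0 < s" "s < t" "t < u"
  shows "(ln (Gamma t) - ln (Gamma s)) / (t - s) \<le> (ln (Gamma u) - ln (Gamma t)) / (u - t)"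
proof -
  define \<theta> where "\<theta> = (t - s) / (u - s)"
  have th: "0 < \<theta>" "\<theta> < 1" using assms by (auto simp: \<theta>_def field_simps)
  have t: "t = (1 - \<theta>) *\<^sub>R s + \<theta> *\<^sub>R u"
  proof -
    have "\<theta> * (u - s) = t - s" using assms by (simp add: \<theta>_def)
    then show ?thesis by (simp add: algebra_simps)
  qed
  have "(ln \<circ> Gamma) ((1 - \<theta>) *\<^sub>R s + \<theta> *\<^sub>R u) \<le> (1 - \<theta>) * (ln \<circ> Gamma) s + \<theta> * (ln \<circ> Gamma) u"
    by (rule convex_onD[OF log_convex_Gamma_real]) (use th assms in auto)
  then have "ln (Gamma t) \<le> (1 - \<theta>) * ln (Gamma s) + \<theta> * ln (Gamma u)"
    unfolding t[symmetric] by simp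
  then have "(u - s) * ln (Gamma t) \<le> (u - s) * ((1 - \<theta>) * ln (Gamma s) + \<theta> * ln (Gamma u))"
    using assms by (intro mult_left_mono) auto
  also have "\<dots> = ((u - s) * (1 - \<theta>)) * ln (Gamma s) + ((u - s) * \<theta>) * ln (Gamma u)"
    by (simp add: algebra_simps)
  also have "(u - s) * \<theta> = t - s" using assms by (simp add: \<theta>_def)
  also have "(u - s) * (1 - \<theta>) = u - t" using assms by (simp add: \<theta>_def field_simps)
  finally show ?thesis using assms by (simp add: field_simps)
qed

text \<open>The logarithm of the ratio has derivative
  \<open>Digamma (z + \<alpha>) - Digamma z\<close>, and Digamma increases on the positive
  axis.\<close>

lemma Gamma_ratio_mono:
  fixes \<alpha> s t :: real
  assumes "0 < \<alpha>" "0 < s" "s \<le> t"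
  shows "Gamma (s + \<alpha>) / Gamma s \<le> Gamma (t + \<alpha>) / Gamma t"
proof (cases "s = t")
  case False
  define g :: "real \<Rightarrow> real" where "g = (\<lambda>x. ln (Gamma x))"
  have "g (s + \<alpha>) - g s \<le> g (t + \<alpha>) - g t"
  proof -
    have "(\<lambda>z. g (z + \<alpha>) - g z) s \<le> (\<lambda>z. g (z + \<alpha>) - g z) t"
    proof (rule DERIV_nonneg_imp_nondecreasing[OF assms(3)])
      fix z assume "s \<le> z" "z \<le> t"
      then have z: "0 < z" using assms by auto
      have "((\<lambda>z. g (z + \<alpha>) - g z) has_real_derivative Digamma (z + \<alpha>) - Digamma z) (at z)"
        unfolding g_def using z assms Gamma_real_pos[of z] Gamma_real_pos[of "z + \<alpha>"]
        by (auto intro!: derivative_eq_intros elim!: nonpos_Ints_cases' simp: less_imp_neq[symmetric])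
      moreover have "Digamma z \<le> Digamma (z + \<alpha>)"
        using z assms by (intro Digamma_real_mono) auto
      ultimately show "\<exists>y. DERIV (\<lambda>z. g (z + \<alpha>) - g z) z :> y \<and> 0 \<le> y" by force
    qed
    then show ?thesis .
  qed
  moreover have "0 < Gamma s" "0 < Gamma t" "0 < Gamma (s + \<alpha>)" "0 < Gamma (t + \<alpha>)"
    using assms by (auto intro!: Gamma_real_pos)
  ultimately have "ln (Gamma (s + \<alpha>) / Gamma s) \<le> ln (Gamma (t + \<alpha>) / Gamma t)"
    by (simp add: g_def ln_div)
  then show ?thesis
    using \<open>0 < Gamma s\<close> \<open>0 < Gamma t\<close> \<open>0 < Gamma (s + \<alpha>)\<close> \<open>0 < Gamma (t + \<alpha>)\<close>
    by (subst (asm) ln_le_cancel_iff) auto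
qed simp

text \<open>By the functional equation the slope of ln Gamma over [x - 1, x] is exactly ln (x - 1),
  and convexity makes the slope over [x, x + \<alpha>] at least as large. Hence quotients of
  consecutive series denominators are unbounded.\<close>

lemma Gamma_ratio_ge:
  fixes \<alpha> x :: real
  assumes "0 < \<alpha>" "1 < x"
  shows "(x - 1) powr \<alpha> \<le> Gamma (x + \<alpha>) / Gamma x"
proof -
  have "x - 1 \<notin> \<int>\<^sub>\<le>\<^sub>0" using assms by (auto elim!: nonpos_Ints_cases')
  then have G: "Gamma x = (x - 1) * Gamma (x - 1)"
    using Gamma_plus1[of "x - 1"] by simp
  have "ln (Gamma x) - ln (Gamma (x - 1)) = ln (x - 1)"
    using assms Gamma_real_pos[of "x - 1"] by (subst G) (simp add: ln_mult less_imp_neq[symmetric])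
  then have "ln (x - 1) \<le> (ln (Gamma (x + \<alpha>)) - ln (Gamma x)) / \<alpha>"
    using Gamma_slope_le[of "x - 1" x "x + \<alpha>"] assms by simp
  then have "\<alpha> * ln (x - 1) \<le> ln (Gamma (x + \<alpha>)) - ln (Gamma x)"
    using assms by (simp add: field_simps)
  also have "\<dots> = ln (Gamma (x + \<alpha>) / Gamma x)"
    using assms Gamma_real_pos[of x] Gamma_real_pos[of "x + \<alpha>"] by (simp add: ln_div less_imp_neq[symmetric])
  finally have "\<alpha> * ln (x - 1) \<le> ln (Gamma (x + \<alpha>) / Gamma x)" .
  then have "exp (\<alpha> * ln (x - 1)) \<le> exp (ln (Gamma (x + \<alpha>) / Gamma x))" by simp
  then show ?thesis using assms by (simp add: powr_def Gamma_real_pos)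
qed

lemma ml_entire_one:
  assumes "0 < \<alpha>" "0 < p"
  shows "ml_entire (\<lambda>_. 1) \<alpha> p"
  unfolding ml_entire_def
proof
  fix x :: real
  have "filterlim (\<lambda>n. (p + \<alpha> * real n - 1) powr \<alpha>) at_top sequentially"
    using assms by real_asymp
  \<comment> \<open>Beyond this threshold each term is at most half of its predecessor in absolute
    value.\<close>
  then have "eventually (\<lambda>n. 2 * \<bar>x\<bar> \<le> (p + \<alpha> * real n - 1) powr \<alpha>) sequentially"
    by (simp add: filterlim_at_top)
  moreover have "filterlim (\<lambda>n. p + \<alpha> * real n) at_top sequentially"
    using assms by real_asymp
  then have "eventually (\<lambda>n. 1 < p + \<alpha> * real n) sequentially"
    by (simp add: filterlim_at_top_dense)
  ultimately have "eventually (\<lambda>n. 2 * \<bar>x\<bar> \<le> (p + \<alpha> * real n - 1) powr \<alpha> \<and> 1 < p + \<alpha> * real n) sequentially"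
    by (rule eventually_conj)
  then obtain N where N: "\<And>n. n \<ge> N \<Longrightarrow> 2 * \<bar>x\<bar> \<le> (p + \<alpha> * real n - 1) powr \<alpha> \<and> 1 < p + \<alpha> * real n"
    unfolding eventually_sequentially by blast
  show "summable (\<lambda>n. 1 * x ^ n / Gamma (p + \<alpha> * real n))"
  proof (rule summable_ratio_test[of "1/2"])
    fix n assume "N \<le> n"
    define y where "y = p + \<alpha> * real n"
    have y: "2 * \<bar>x\<bar> \<le> (y - 1) powr \<alpha>" "1 < y" using N[OF \<open>N \<le> n\<close>] by (auto simp: y_def)
    have pos: "0 < Gamma y" "0 < Gamma (y + \<alpha>)" using y assms by (auto intro!: Gamma_real_pos)
    have "2 * \<bar>x\<bar> \<le> Gamma (y + \<alpha>) / Gamma y"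
      using Gamma_ratio_ge[OF assms(1) y(2)] y by linarith
    then have "\<bar>x\<bar> / Gamma (y + \<alpha>) \<le> (1/2) / Gamma y"
      using pos by (simp add: field_simps)
    then have "\<bar>x\<bar> ^ n * (\<bar>x\<bar> / Gamma (y + \<alpha>)) \<le> \<bar>x\<bar> ^ n * ((1/2) / Gamma y)"
      by (intro mult_left_mono) auto
    moreover have "p + \<alpha> * real (Suc n) = y + \<alpha>" by (simp add: y_def algebra_simps)
    ultimately show "norm (1 * x ^ Suc n / Gamma (p + \<alpha> * real (Suc n)))
        \<le> 1/2 * norm (1 * x ^ n / Gamma (p + \<alpha> * real n))"
      using pos by (simp add: y_def[symmetric] abs_mult power_abs mult_ac)
  qed simp
qed

lemma ml_entire_delta: "ml_entire (\<lambda>n. if n = 0 then c else 0) \<alpha> p"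
  unfolding ml_entire_def by (auto intro!: summable_finite[of "{0}"] split: if_splits)

lemma ml_series_delta: "ml_series (\<lambda>n. if n = 0 then c else 0) \<alpha> p x = c / Gamma p"
  unfolding ml_series_def by (subst suminf_finite[of "{0}"]) auto

section \<open>Beta convolution of two series\<close>

text \<open>This is the Cauchy product at a fixed \<open>u\<close>. The powers of
  \<open>u powr \<alpha>\<close> and \<open>(1 - u) powr \<alpha>\<close> are absorbed into the
  weight, so each summand is a multiple of a Beta integrand.\<close>

lemma ml_series_integrand_sums:
  assumes "ml_entire a \<alpha> p" "ml_entire b \<alpha> q" "u \<in> {0<..<1}"
  shows "(\<lambda>k. \<Sum>i\<le>k. a i * b (k - i) / (Gamma (p + \<alpha> * i) * Gamma (q + \<alpha> * (k - i)))
            * x ^ k * (u powr (p + \<alpha> * i - 1) * (1 - u) powr (q + \<alpha> * (k - i) - 1)))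
         sums (u powr (p - 1) * (1 - u) powr (q - 1) *
               (ml_series a \<alpha> p (x * u powr \<alpha>) * ml_series b \<alpha> q (x * (1 - u) powr \<alpha>)))"
proof -
  have pw: "(v powr \<alpha>) ^ i * v powr (s - 1) = v powr (s + \<alpha> * real i - 1)"
    if "0 < v" for v s :: real and i :: nat
  proof -
    have "(v powr \<alpha>) ^ i = v powr (\<alpha> * real i)"
      using that by (subst powr_realpow[symmetric]) (auto simp: powr_powr)
    then show ?thesis by (simp add: powr_add[symmetric] algebra_simps)
  qed
  let ?f = "\<lambda>i. a i * (x * u powr \<alpha>) ^ i / Gamma (p + \<alpha> * real i)"
  let ?g = "\<lambda>i. b i * (x * (1 - u) powr \<alpha>) ^ i / Gamma (q + \<alpha> * real i)"
  have "(\<lambda>k. \<Sum>i\<le>k. ?f i * ?g (k - i)) sums (ml_series a \<alpha> p (x * u powr \<alpha>) * ml_series b \<alpha> q (x * (1 - u) powr \<alpha>))"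
    unfolding ml_series_def
    by (rule Cauchy_product_sums)
       (use ml_entire_abs[OF assms(1)] ml_entire_abs[OF assms(2)] in auto)
  then have "(\<lambda>k. u powr (p - 1) * (1 - u) powr (q - 1) * (\<Sum>i\<le>k. ?f i * ?g (k - i)))
      sums (u powr (p - 1) * (1 - u) powr (q - 1) * (ml_series a \<alpha> p (x * u powr \<alpha>) * ml_series b \<alpha> q (x * (1 - u) powr \<alpha>)))"
    by (rule sums_mult)
  moreover have "u powr (p - 1) * (1 - u) powr (q - 1) * (\<Sum>i\<le>k. ?f i * ?g (k - i)) =
    (\<Sum>i\<le>k. a i * b (k - i) / (Gamma (p + \<alpha> * i) * Gamma (q + \<alpha> * (k - i)))
            * x ^ k * (u powr (p + \<alpha> * i - 1) * (1 - u) powr (q + \<alpha> * (k - i) - 1)))" for k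
    unfolding sum_distrib_left
  proof (rule sum.cong[OF refl])
    fix i assume "i \<in> {..k}"
    then have xk: "x ^ k = x ^ i * x ^ (k - i)" and r: "real k - real i = real (k - i)"
      by (auto simp: power_add[symmetric])
    show "u powr (p - 1) * (1 - u) powr (q - 1) * (?f i * ?g (k - i)) =
      a i * b (k - i) / (Gamma (p + \<alpha> * i) * Gamma (q + \<alpha> * (k - i)))
            * x ^ k * (u powr (p + \<alpha> * i - 1) * (1 - u) powr (q + \<alpha> * (k - i) - 1))"
      using assms(3) unfolding xk r by (simp add: pw[symmetric] power_mult_distrib)
  qed
  ultimately show ?thesis by simp
qed

text \<open>Termwise integration: in degree k the two Beta parameters always add up to p + q +
  \<alpha> k, so the Gamma factors of the two series cancel against those of the Beta value and only
  the Cauchy product of the coefficients is left.\<close>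

lemma ml_series_convolution:
  fixes \<alpha> p q x :: real
  assumes "0 < \<alpha>" "0 < p" "0 < q" "ml_entire a \<alpha> p" "ml_entire b \<alpha> q"
  shows "set_integrable lborel {0<..<1} (\<lambda>u. u powr (p - 1) * (1 - u) powr (q - 1) *
               (ml_series a \<alpha> p (x * u powr \<alpha>) * ml_series b \<alpha> q (x * (1 - u) powr \<alpha>)))" (is "?I")
    and "(LINT u:{0<..<1}|lborel. u powr (p - 1) * (1 - u) powr (q - 1) *
               (ml_series a \<alpha> p (x * u powr \<alpha>) * ml_series b \<alpha> q (x * (1 - u) powr \<alpha>)))
         = ml_series (cauchy_prod a b) \<alpha> (p + q) x" (is "?E")
    and "summable (\<lambda>n. cauchy_prod a b n * x ^ n / Gamma (p + q + \<alpha> * real n))" (is "?S")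
proof -
  let ?w = "\<lambda>s t u::real. u powr (s - 1) * (1 - u) powr (t - 1)"
  have wint: "set_integrable lborel {0<..<1} (?w s t)" if "0 < s" "0 < t" for s t
    by (rule set_integrable_subset[OF integrable_Beta[OF that]]) auto
  have wval: "(LINT u:{0<..<1}|lborel. ?w s t u) = Beta s t" if "0 < s" "0 < t" for s t
    using set_borel_integral_eq_integral(2)[OF wint[OF that]] has_integral_Beta_real[OF that]
    by (simp add: has_integral_Icc_iff_Ioo integral_unique)
  define c where "c = (\<lambda>k i. a i * b (k - i) / (Gamma (p + \<alpha> * i) * Gamma (q + \<alpha> * (k - i))))"
  define W where "W = (\<lambda>k i u. indicator {0<..<1} u *\<^sub>R ?w (p + \<alpha> * real i) (q + \<alpha> * (real k - real i)) u)"
  have Wi: "integrable lborel (W k i)" if "i \<le> k" for k i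
    using wint[of "p + \<alpha> * real i" "q + \<alpha> * (real k - real i)"] assms that
    unfolding W_def set_integrable_def by (auto simp: add_pos_nonneg)
  have Wv: "integral\<^sup>L lborel (W k i) = Beta (p + \<alpha> * real i) (q + \<alpha> * (real k - real i))" if "i \<le> k" for k i
    using wval[of "p + \<alpha> * real i" "q + \<alpha> * (real k - real i)"] assms that
    unfolding W_def set_lebesgue_integral_def by (auto simp: add_pos_nonneg)
  have cB: "c k i * Beta (p + \<alpha> * real i) (q + \<alpha> * (real k - real i)) = a i * b (k - i) / Gamma (p + q + \<alpha> * real k)"
    if "i \<le> k" for k i
  proof -
    have "Gamma (p + \<alpha> * real i) > 0" "Gamma (q + \<alpha> * (real k - real i)) > 0"
      using assms that by (auto intro!: Gamma_real_pos add_pos_nonneg)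
    moreover have "p + \<alpha> * real i + (q + \<alpha> * (real k - real i)) = p + q + \<alpha> * real k"
      by (simp add: algebra_simps)
    moreover from this have "Gamma (p + \<alpha> * real i + (q + \<alpha> * (real k - real i))) = Gamma (p + q + \<alpha> * real k)"
      by (rule arg_cong)
    ultimately show ?thesis using that by (simp add: c_def Beta_def of_nat_diff)
  qed
  define f where "f = (\<lambda>k u. \<Sum>i\<le>k. c k i * x ^ k * W k i u)"
  have fi: "integrable lborel (f k)" for k
    unfolding f_def by (intro Bochner_Integration.integrable_sum integrable_mult_right Wi) auto
  have fv: "integral\<^sup>L lborel (f k) = cauchy_prod a b k * x ^ k / Gamma (p + q + \<alpha> * real k)" for k
  proof -
    have "integral\<^sup>L lborel (f k) = (\<Sum>i\<le>k. c k i * x ^ k * integral\<^sup>L lborel (W k i))"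
      unfolding f_def by (subst Bochner_Integration.integral_sum) (auto intro!: integrable_mult_right Wi)
    also have "\<dots> = (\<Sum>i\<le>k. a i * b (k - i) / Gamma (p + q + \<alpha> * real k) * x ^ k)"
      by (intro sum.cong refl) (auto simp: Wv cB[symmetric])
    finally show ?thesis by (simp add: cauchy_prod_def sum_distrib_right sum_divide_distrib)
  qed
  \<comment> \<open>Since Beta decreases in both arguments, the coefficients of the product series are
    dominated by those of the product of the two series.\<close>
  let ?d = "\<lambda>a p i. \<bar>a i * x ^ i / Gamma (p + \<alpha> * real i)\<bar>"
  have dsum: "summable (\<lambda>k. \<Sum>i\<le>k. ?d a p i * ?d b q (k - i))"
    using ml_entire_abs[OF assms(4)] ml_entire_abs[OF assms(5)]
    by (intro summable_Cauchy_product) auto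
  have nb: "(\<integral>u. norm (f k u) \<partial>lborel) \<le> Beta p q * (\<Sum>i\<le>k. ?d a p i * ?d b q (k - i))" for k
  proof -
    have "(\<integral>u. norm (f k u) \<partial>lborel) \<le> (\<integral>u. (\<Sum>i\<le>k. \<bar>c k i * x ^ k\<bar> * W k i u) \<partial>lborel)"
    proof (rule integral_mono)
      show "integrable lborel (\<lambda>u. norm (f k u))" using fi by (rule integrable_norm)
      show "integrable lborel (\<lambda>u. \<Sum>i\<le>k. \<bar>c k i * x ^ k\<bar> * W k i u)"
        by (intro Bochner_Integration.integrable_sum integrable_mult_right Wi) auto
      have "W k i u \<ge> 0" for i u unfolding W_def by auto
      then show "norm (f k u) \<le> (\<Sum>i\<le>k. \<bar>c k i * x ^ k\<bar> * W k i u)" for u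
        unfolding f_def by (intro order_trans[OF norm_sum]) (auto simp: abs_mult)
    qed
    also have "\<dots> = (\<Sum>i\<le>k. \<bar>c k i * x ^ k\<bar> * Beta (p + \<alpha> * real i) (q + \<alpha> * (real k - real i)))"
      by (subst Bochner_Integration.integral_sum) (auto intro!: integrable_mult_right Wi simp: Wv)
    also have "\<dots> \<le> (\<Sum>i\<le>k. \<bar>c k i * x ^ k\<bar> * Beta p q)"
      using assms by (intro sum_mono mult_left_mono Beta_real_mono) auto
    also have "\<dots> = Beta p q * (\<Sum>i\<le>k. ?d a p i * ?d b q (k - i))"
      unfolding sum_distrib_left
    proof (rule sum.cong[OF refl])
      fix i assume "i \<in> {..k}"
      then have "x ^ k = x ^ i * x ^ (k - i)" by (auto simp: power_add[symmetric])
      then show "\<bar>c k i * x ^ k\<bar> * Beta p q = Beta p q * (?d a p i * ?d b q (k - i))"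
        by (simp add: c_def abs_mult)
    qed
    finally show ?thesis .
  qed
  have nsum: "summable (\<lambda>k. \<integral>u. norm (f k u) \<partial>lborel)"
    by (rule summable_comparison_test'[OF summable_mult[OF dsum, of "Beta p q"], of 0]) (use nb in auto)
  let ?h = "\<lambda>u. ?w p q u * (ml_series a \<alpha> p (x * u powr \<alpha>) * ml_series b \<alpha> q (x * (1 - u) powr \<alpha>))"
  have fs: "(\<lambda>k. f k u) sums (indicator {0<..<1} u *\<^sub>R ?h u)" for u
  proof (cases "u \<in> {0<..<1}")
    case True
    then show ?thesis
      using ml_series_integrand_sums[OF assms(4,5) True, of x]
      by (simp add: f_def c_def W_def of_nat_diff)
  qed (auto simp: f_def W_def)
  have ns: "summable (\<lambda>k. norm (f k u))" for u
  proof (cases "u \<in> {0<..<1}")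
    case True
    \<comment> \<open>Pointwise absolute summability comes from the same Cauchy product, taken for
      the absolute values of \<open>a\<close>, \<open>b\<close> and \<open>x\<close>.\<close>
    have e: "ml_entire (\<lambda>n. \<bar>a n\<bar>) \<alpha> p" "ml_entire (\<lambda>n. \<bar>b n\<bar>) \<alpha> q"
    proof -
      have *: "ml_entire (\<lambda>n. \<bar>a n\<bar>) \<alpha> p" if "ml_entire a \<alpha> p" "0 < p" for a p
        unfolding ml_entire_def
      proof
        fix y
        have "summable (\<lambda>n. norm (\<bar>a n\<bar> * y ^ n / Gamma (p + \<alpha> * real n)))"
          using ml_entire_abs[OF that(1), of y] by (simp add: abs_mult)
        then show "summable (\<lambda>n. \<bar>a n\<bar> * y ^ n / Gamma (p + \<alpha> * real n))"
          by (rule summable_norm_cancel)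
      qed
      show "ml_entire (\<lambda>n. \<bar>a n\<bar>) \<alpha> p" "ml_entire (\<lambda>n. \<bar>b n\<bar>) \<alpha> q"
        using * assms by auto
    qed
    show ?thesis
    proof (rule summable_comparison_test'[OF sums_summable[OF ml_series_integrand_sums[OF e True, of "\<bar>x\<bar>"]], of 0])
      fix k
      have "norm (f k u) \<le> (\<Sum>i\<le>k. norm (c k i * x ^ k * W k i u))"
        unfolding f_def by (rule norm_sum)
      also have "\<dots> = (\<Sum>i\<le>k. \<bar>a i\<bar> * \<bar>b (k - i)\<bar> / (Gamma (p + \<alpha> * i) * Gamma (q + \<alpha> * (k - i)))
            * \<bar>x\<bar> ^ k * (u powr (p + \<alpha> * i - 1) * (1 - u) powr (q + \<alpha> * (k - i) - 1)))"
      proof (rule sum.cong[OF refl])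
        fix i assume "i \<in> {..k}"
        then have "Gamma (p + \<alpha> * real i) > 0" "Gamma (q + \<alpha> * (real k - real i)) > 0"
          using assms by (auto intro!: Gamma_real_pos add_pos_nonneg)
        then show "norm (c k i * x ^ k * W k i u) = \<bar>a i\<bar> * \<bar>b (k - i)\<bar> / (Gamma (p + \<alpha> * i) * Gamma (q + \<alpha> * (k - i)))
            * \<bar>x\<bar> ^ k * (u powr (p + \<alpha> * i - 1) * (1 - u) powr (q + \<alpha> * (k - i) - 1))"
          using True \<open>i \<in> {..k}\<close> by (simp add: c_def W_def abs_mult power_abs of_nat_diff)
      qed
      finally show "norm (norm (f k u)) \<le> (\<Sum>i\<le>k. \<bar>a i\<bar> * \<bar>b (k - i)\<bar> / (Gamma (p + \<alpha> * i) * Gamma (q + \<alpha> * (k - i)))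
            * \<bar>x\<bar> ^ k * (u powr (p + \<alpha> * i - 1) * (1 - u) powr (q + \<alpha> * (k - i) - 1)))" by simp
    qed
  qed (auto simp: f_def W_def)
  have eq: "(\<lambda>u. \<Sum>k. f k u) = (\<lambda>u. indicator {0<..<1} u *\<^sub>R ?h u)"
    using fs by (auto simp: sums_iff)
  have AE: "AE u in lborel. summable (\<lambda>k. norm (f k u))" using ns by auto
  show ?I
    using integrable_suminf[OF fi AE nsum] unfolding eq set_integrable_def .
  show ?S
    using summable_integral[OF fi AE nsum] unfolding fv .
  show ?E
    using integral_suminf[OF fi AE nsum] unfolding eq fv set_lebesgue_integral_def ml_series_def .
qed

lemma ml_entire_cauchy_prod:
  assumes "0 < \<alpha>" "0 < p" "0 < q" "ml_entire a \<alpha> p" "ml_entire b \<alpha> q"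
  shows "ml_entire (cauchy_prod a b) \<alpha> (p + q)"
  unfolding ml_entire_def using ml_series_convolution(3)[OF assms] by blast

text \<open>So convolution with a constant raises the second parameter and merely rescales the
  coefficients.\<close>

lemma cauchy_prod_delta: "cauchy_prod a (\<lambda>n. if n = 0 then c else 0) = (\<lambda>k. a k * c)"
proof
  fix k
  have "(\<Sum>i\<le>k. a i * (if k - i = 0 then c else 0)) = (\<Sum>i\<in>{k}. a i * c)"
    by (intro sum.mono_neutral_cong_right) auto
  then show "cauchy_prod a (\<lambda>n. if n = 0 then c else 0) k = a k * c" by (simp add: cauchy_prod_def)
qed

text \<open>Convolution with the series supported at 0, whose value is 1 / Gamma q. Multiplied by
  \<open>Gamma p / Beta p q\<close>, it is the representation as a mean over a Beta
  distribution.\<close>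

lemma ml_series_mixture:
  assumes "0 < \<alpha>" "0 < p" "0 < q" "ml_entire a \<alpha> p"
  shows "set_integrable lborel {0<..<1} (\<lambda>u. u powr (p - 1) * (1 - u) powr (q - 1) * ml_series a \<alpha> p (x * u powr \<alpha>))"
    and "(LINT u:{0<..<1}|lborel. u powr (p - 1) * (1 - u) powr (q - 1) * ml_series a \<alpha> p (x * u powr \<alpha>))
       = Gamma q * ml_series a \<alpha> (p + q) x"
proof -
  note conv = ml_series_convolution[OF assms ml_entire_delta[of 1], of x, unfolded ml_series_delta cauchy_prod_delta mult_1_right]
  have G: "Gamma q > 0" using assms by (simp add: Gamma_real_pos)
  have eq: "u powr (p - 1) * (1 - u) powr (q - 1) * ml_series a \<alpha> p (x * u powr \<alpha>) =
     Gamma q * (u powr (p - 1) * (1 - u) powr (q - 1) * (ml_series a \<alpha> p (x * u powr \<alpha>) * (1 / Gamma q)))" for u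
    using G by simp
  show "set_integrable lborel {0<..<1} (\<lambda>u. u powr (p - 1) * (1 - u) powr (q - 1) * ml_series a \<alpha> p (x * u powr \<alpha>))"
    unfolding eq by (intro set_integrable_mult_right conv(1))
  show "(LINT u:{0<..<1}|lborel. u powr (p - 1) * (1 - u) powr (q - 1) * ml_series a \<alpha> p (x * u powr \<alpha>))
       = Gamma q * ml_series a \<alpha> (p + q) x"
    unfolding eq set_integral_mult_right conv(2) ..
qed

text \<open>The exceptional point \<open>v\<close> is a null set; it accommodates the one
  \<open>u\<close> at which a tangent line touches a strictly convex function.\<close>

lemma set_integral_pos_Ioo:
  fixes f :: "real \<Rightarrow> real"
  assumes int: "set_integrable lborel {0<..<1} f"
    and pos: "\<And>u. u \<in> {0<..<1} \<Longrightarrow> u \<noteq> v \<Longrightarrow> 0 < f u"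
  shows "0 < (LINT u:{0<..<1}|lborel. f u)"
proof -
  let ?g = "\<lambda>u. indicator {0<..<1} u *\<^sub>R f u"
  have i: "integrable lborel ?g" using int by (simp add: set_integrable_def)
  have nn: "AE u in lborel. 0 \<le> ?g u"
    using AE_lborel_singleton[of v] by eventually_elim (use pos in \<open>force simp: indicator_def\<close>)
  have "\<not> (AE u in lborel. ?g u = 0)"
  proof
    assume "AE u in lborel. ?g u = 0"
    then have "AE u in lborel. u \<notin> {0<..<1::real}"
      using AE_lborel_singleton[of v] by eventually_elim (use pos in \<open>force simp: indicator_def\<close>)
    then have "emeasure lborel {0<..<1::real} = 0"
      by (subst (asm) AE_iff_null_sets[symmetric]) (auto simp: null_sets_def)
    then show False by simp
  qed
  then have "integral\<^sup>L lborel ?g \<noteq> 0"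
    using integral_nonneg_eq_0_iff_AE[OF i nn] by simp
  moreover have "integral\<^sup>L lborel ?g \<ge> 0" using nn by (rule integral_nonneg_AE)
  ultimately show ?thesis unfolding set_lebesgue_integral_def by simp
qed

text \<open>For x \<le> 0 both arguments in the convolution integral are again nonpositive, so its
  integrand is positive.\<close>

lemma ml_series_pos_cauchy_prod:
  assumes "0 < \<alpha>" "0 < p" "0 < q" "ml_entire a \<alpha> p" "ml_entire b \<alpha> q"
    and "\<And>x. x \<le> 0 \<Longrightarrow> 0 < ml_series a \<alpha> p x" "\<And>x. x \<le> 0 \<Longrightarrow> 0 < ml_series b \<alpha> q x" "x \<le> 0"
  shows "0 < ml_series (cauchy_prod a b) \<alpha> (p + q) x"
  unfolding ml_series_convolution(2)[OF assms(1-5), symmetric]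
  by (rule set_integral_pos_Ioo[OF ml_series_convolution(1)[OF assms(1-5)]])
     (use assms(6-8) in \<open>auto intro!: mult_pos_pos simp: mult_nonpos_nonneg\<close>)

subsection \<open>Positivity of the resolvent\<close>

text \<open>Splitting off the term of index 0; both the Volterra equation and the recursion in
  \<beta> rest on this identity.\<close>

lemma ml_series_one_shift:
  assumes "0 < \<alpha>" "0 < p"
  shows "ml_series (\<lambda>_. 1) \<alpha> p x = 1 / Gamma p + x * ml_series (\<lambda>_. 1) \<alpha> (p + \<alpha>) x"
proof -
  have "summable (\<lambda>n. 1 * x ^ n / Gamma (p + \<alpha> * real n))"
    "summable (\<lambda>n. 1 * x ^ n / Gamma (p + \<alpha> + \<alpha> * real n))"
    using ml_entire_one[of \<alpha> p] ml_entire_one[of \<alpha> "p + \<alpha>"] assms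
    unfolding ml_entire_def by auto
  then show ?thesis
    using suminf_split_head[of "\<lambda>n. 1 * x ^ n / Gamma (p + \<alpha> * real n)"]
      suminf_mult[of "\<lambda>n. 1 * x ^ n / Gamma (p + \<alpha> + \<alpha> * real n)" x]
    unfolding ml_series_def by (simp add: algebra_simps)
qed

text \<open>Termwise differentiation shifts the index by one, which turns \<open>p\<close> into
  \<open>p + \<alpha>\<close>.\<close>

lemma ml_series_has_derivative:
  assumes "ml_entire a \<alpha> p"
  shows "(ml_series a \<alpha> p has_real_derivative ml_series (\<lambda>n. real (Suc n) * a (Suc n)) \<alpha> (p + \<alpha>) x) (at x)"
proof -
  have "((\<lambda>x. \<Sum>n. a n / Gamma (p + \<alpha> * real n) * x ^ n) has_real_derivative
      (\<Sum>n. diffs (\<lambda>n. a n / Gamma (p + \<alpha> * real n)) n * x ^ n)) (at x)"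
    by (rule termdiffs_strong_converges_everywhere)
       (use assms in \<open>auto simp: ml_entire_def\<close>)
  then show ?thesis
    by (simp add: ml_series_def[abs_def] diffs_def algebra_simps)
qed

lemma ml_series_pos_right:
  assumes "0 < \<alpha>" "0 < p" "ml_entire a \<alpha> p" "\<And>n. 0 < a n" "0 \<le> x"
  shows "0 < ml_series a \<alpha> p x"
  unfolding ml_series_def
proof (rule suminf_pos2[of _ 0])
  show "summable (\<lambda>n. a n * x ^ n / Gamma (p + \<alpha> * real n))"
    using assms by (simp add: ml_entire_def)
  have "Gamma (p + \<alpha> * real n) > 0" for n
    using assms by (intro Gamma_real_pos add_pos_nonneg) auto
  then show "0 \<le> a n * x ^ n / Gamma (p + \<alpha> * real n)" for n
    using assms by (auto intro!: divide_nonneg_pos mult_nonneg_nonneg simp: less_imp_le)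
  show "0 < a 0 * x ^ 0 / Gamma (p + \<alpha> * real 0)"
    using assms by (simp add: Gamma_real_pos)
qed

text \<open>The resolvent equation for the kernel \<open>s powr (\<alpha> - 1)\<close>, solved for
  the integral. The mixture formula with both parameters \<alpha>, rescaled from (0, 1) to (0, v),
  produces the series with parameter 2 \<alpha>, and \<open>ml_series_one_shift\<close> brings it
  back to parameter \<alpha>.\<close>

lemma ml_series_volterra:
  fixes \<alpha> y v :: real
  assumes "0 < \<alpha>" "0 < y" "0 < v"
  defines "h \<equiv> \<lambda>s. s powr (\<alpha> - 1) * ml_series (\<lambda>_. 1) \<alpha> \<alpha> (- y * s powr \<alpha>)"
  shows "((\<lambda>s. (v - s) powr (\<alpha> - 1) * h s) has_integral (v powr (\<alpha> - 1) - Gamma \<alpha> * h v) / y) {0..v}"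
proof -
  define E where "E = ml_series (\<lambda>_. 1) \<alpha>"
  define x where "x = - y * v powr \<alpha>"
  let ?g = "\<lambda>u. u powr (\<alpha> - 1) * (1 - u) powr (\<alpha> - 1) * E \<alpha> (x * u powr \<alpha>)"
  have G: "Gamma \<alpha> > 0" using assms by (simp add: Gamma_real_pos)
  have "(?g has_integral Gamma \<alpha> * E (\<alpha> + \<alpha>) x) {0<..<1}"
    using set_borel_integral_eq_integral[OF ml_series_mixture(1)[OF assms(1,1,1) ml_entire_one[OF assms(1,1)], of x]]
      ml_series_mixture(2)[OF assms(1,1,1) ml_entire_one[OF assms(1,1)], of x]
    by (simp add: has_integral_iff E_def)
  then have "(?g has_integral Gamma \<alpha> * E (\<alpha> + \<alpha>) x) (cbox 0 1)"
    by (simp add: has_integral_Icc_iff_Ioo)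
  from has_integral_affinity'[OF this, of "1 / v" 0]
  have "((\<lambda>s. ?g (s / v)) has_integral v * (Gamma \<alpha> * E (\<alpha> + \<alpha>) x)) {0..v}"
    using assms by simp
  \<comment> \<open>The factor undoes the two powers of v that come from
    \<open>(s / v) powr (\<alpha> - 1)\<close> and
    \<open>(1 - s / v) powr (\<alpha> - 1)\<close>.\<close>
  then have "((\<lambda>s. v powr (2 * \<alpha> - 2) * ?g (s / v)) has_integral v powr (2 * \<alpha> - 2) * (v * (Gamma \<alpha> * E (\<alpha> + \<alpha>) x))) {0..v}"
    by (rule has_integral_mult_right)
  moreover have "v powr (2 * \<alpha> - 2) * (v * (Gamma \<alpha> * E (\<alpha> + \<alpha>) x)) = (v powr (\<alpha> - 1) - Gamma \<alpha> * h v) / y"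
  proof -
    have "Gamma \<alpha> * E \<alpha> x = 1 - y * v powr \<alpha> * (Gamma \<alpha> * E (\<alpha> + \<alpha>) x)"
      using G ml_series_one_shift[OF assms(1,1), of x] by (simp add: E_def x_def field_simps)
    then have "Gamma \<alpha> * h v = v powr (\<alpha> - 1) * (1 - y * v powr \<alpha> * (Gamma \<alpha> * E (\<alpha> + \<alpha>) x))"
      by (simp add: h_def E_def x_def mult_ac)
    moreover have "v powr (\<alpha> - 1) * v powr \<alpha> = v powr (2 * \<alpha> - 2) * v"
    proof -
      have "v powr (\<alpha> - 1) * v powr \<alpha> = v powr (2 * \<alpha> - 2) * v powr 1"
        by (simp only: powr_add[symmetric]) simp
      then show ?thesis using assms by simp
    qed
    moreover have "v powr (\<alpha> - 1) - v powr (\<alpha> - 1) * (1 - y * v powr \<alpha> * (Gamma \<alpha> * E (\<alpha> + \<alpha>) x))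
        = y * ((v powr (\<alpha> - 1) * v powr \<alpha>) * (Gamma \<alpha> * E (\<alpha> + \<alpha>) x))"
      by (simp add: algebra_simps)
    ultimately have "v powr (\<alpha> - 1) - Gamma \<alpha> * h v = y * (v powr (2 * \<alpha> - 2) * (v * (Gamma \<alpha> * E (\<alpha> + \<alpha>) x)))"
      by (simp only: mult.assoc)
    then show ?thesis using \<open>0 < y\<close> by simp
  qed
  \<comment> \<open>At both endpoints the two sides vanish, since \<open>0 powr a = 0\<close> for
    every exponent.\<close>
  moreover have "v powr (2 * \<alpha> - 2) * ?g (s / v) = (v - s) powr (\<alpha> - 1) * h s" if "s \<in> {0..v}" for s
  proof -
    have "(s / v) powr (\<alpha> - 1) = s powr (\<alpha> - 1) / v powr (\<alpha> - 1)"
      "(s / v) powr \<alpha> = s powr \<alpha> / v powr \<alpha>"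
      using that assms by (auto simp: powr_divide)
    moreover have "(1 - s / v) powr (\<alpha> - 1) = (v - s) powr (\<alpha> - 1) / v powr (\<alpha> - 1)"
      using that assms by (subst powr_divide[symmetric]) (auto simp: field_simps)
    moreover have "v powr (2 * \<alpha> - 2) = v powr (\<alpha> - 1) * v powr (\<alpha> - 1)"
      by (simp add: powr_add[symmetric])
    ultimately show ?thesis using assms by (simp add: h_def E_def x_def)
  qed
  ultimately show ?thesis by (subst has_integral_cong[symmetric]) auto
qed

lemma ml_series_one_continuous: "0 < \<alpha> \<Longrightarrow> 0 < p \<Longrightarrow> continuous_on A (ml_series (\<lambda>_. 1) \<alpha> p)"
  by (rule DERIV_continuous_on, rule has_field_derivative_at_within, rule ml_series_has_derivative)
     (rule ml_entire_one)

text \<open>At the first zero of the solution \<open>h\<close> of the Volterra equation, normalised to be 1, the log-convexity of the kernel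
  \<open>s powr (\<alpha> - 1)\<close> contradicts that equation on \<open>{0..v}\<close>, where \<open>v\<close>
  maximises \<open>h\<close> near 1.\<close>
lemma ml_series_one_pos_left:
  fixes \<alpha> x :: real
  assumes "0 < \<alpha>" "\<alpha> \<le> 1" "x \<le> 0"
  shows "0 < ml_series (\<lambda>_. 1) \<alpha> \<alpha> x"
proof (rule ccontr)
  assume neg: "\<not> ?thesis"
  define E where "E = ml_series (\<lambda>_. 1) \<alpha> \<alpha>"
  have cE: "continuous_on A E" for A
    unfolding E_def using assms by (intro ml_series_one_continuous)
  have G: "Gamma \<alpha> > 0" using assms by (simp add: Gamma_real_pos)
  have E0: "E 0 = 1 / Gamma \<alpha>"
    using ml_series_one_shift[of \<alpha> \<alpha> 0] assms by (simp add: E_def)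
  \<comment> \<open>\<open>S\<close> is closed, and nonempty by the negated goal, so its infimum
    \<open>y\<close> is attained; \<open>E0\<close> makes it positive. With this \<open>y\<close> as
    the factor in \<open>h\<close>, the first failure of positivity sits at s = 1.\<close>
  define S where "S = {y. 0 \<le> y \<and> E (- y) \<le> 0}"
  have "closed S"
    unfolding S_def
    by (intro closed_Collect_conj closed_Collect_le continuous_intros continuous_on_compose2[OF cE]) auto
  moreover have "- x \<in> S" using neg assms by (simp add: S_def E_def)
  moreover have bS: "bdd_below S" by (auto simp: S_def bdd_below_def)
  ultimately have "Inf S \<in> S" by (intro closed_contains_Inf) auto
  define y where "y = Inf S"
  have "0 \<le> y" "E (- y) \<le> 0" using \<open>Inf S \<in> S\<close> by (auto simp: S_def y_def)
  then have y: "0 < y" using E0 G by (cases "y = 0") auto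
  have Epos: "0 < E (- z)" if "0 \<le> z" "z < y" for z
    using cInf_lower[OF _ bS, of z] that by (force simp: S_def y_def)
  define h where "h = (\<lambda>s. s powr (\<alpha> - 1) * E (- y * s powr \<alpha>))"
  have h1: "h 1 \<le> 0" using \<open>E (- y) \<le> 0\<close> by (simp add: h_def)
  have hpos: "0 < h s" if "0 < s" "s < 1" for s
  proof -
    have "s powr \<alpha> < 1 powr \<alpha>" using that assms by (intro powr_less_mono2) auto
    then show ?thesis using that Epos[of "y * s powr \<alpha>"] y by (simp add: h_def)
  qed
  have J: "((\<lambda>s. (v - s) powr (\<alpha> - 1) * h s) has_integral (v powr (\<alpha> - 1) - Gamma \<alpha> * h v) / y) {0..v}"
    if "0 < v" for v
    using ml_series_volterra[OF assms(1) y that] by (simp add: h_def E_def)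
  \<comment> \<open>This difference will be the factor of \<open>h v\<close> in the final estimate.
    Its limit at 1 is Gamma \<alpha> > 0, so it is positive near 1.\<close>
  have "((\<lambda>v. Gamma \<alpha> * v powr (1 - \<alpha>) - y * (1 - v) powr \<alpha> / \<alpha>) \<longlongrightarrow>
      Gamma \<alpha> * 1 powr (1 - \<alpha>) - y * (1 - 1) powr \<alpha> / \<alpha>) (at_left 1)"
    by (intro tendsto_intros) (use assms in \<open>auto simp: eventually_at_left_field intro: exI[of _ 0]\<close>)
  then have "eventually (\<lambda>v. 0 < Gamma \<alpha> * v powr (1 - \<alpha>) - y * (1 - v) powr \<alpha> / \<alpha>) (at_left 1)"
    using G by (intro order_tendstoD(1)) auto
  then have "eventually (\<lambda>v. y * (1 - v) powr \<alpha> / \<alpha> < Gamma \<alpha> * v powr (1 - \<alpha>)) (at_left 1)"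
    by simp
  then obtain b where b: "b < 1" "\<And>v. b < v \<Longrightarrow> v < 1 \<Longrightarrow> y * (1 - v) powr \<alpha> / \<alpha> < Gamma \<alpha> * v powr (1 - \<alpha>)"
    unfolding eventually_at_left_field by blast
  \<comment> \<open>\<open>c\<close> lies between \<open>b\<close> and 1 and stays away from 0,
    where \<open>h\<close> may be singular.\<close>
  define c where "c = max (1/2) ((b + 1) / 2)"
  have c: "0 < c" "b < c" "c < 1" using b(1) by (auto simp: c_def max_def)
  have "continuous_on {c..1} h"
    unfolding h_def using c assms
    by (intro continuous_intros continuous_on_compose2[OF cE[of UNIV]]) auto
  then obtain v where v: "v \<in> {c..1}" "\<And>s. s \<in> {c..1} \<Longrightarrow> h s \<le> h v"
    using continuous_attains_sup[of "{c..1}" h] c by auto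
  have "v \<noteq> 1" using v(2)[of c] h1 hpos[of c] c by auto
  then have v01: "0 < v" "v < 1" "b < v" using v c by auto
  let ?f = "\<lambda>s. (1 - s) powr (\<alpha> - 1) * h s"
  have f: "(?f has_integral (1 - Gamma \<alpha> * h 1) / y) {0..1}" using J[of 1] by simp
  have fi: "?f integrable_on {0..v}" "?f integrable_on {v..1}"
    using has_integral_integrable[OF f] v01 by (auto intro: integrable_on_subinterval)
  have tot: "integral {0..v} ?f + integral {v..1} ?f = (1 - Gamma \<alpha> * h 1) / y"
    using Henstock_Kurzweil_Integration.integral_combine[OF _ _ has_integral_integrable[OF f], of v] v01 integral_unique[OF f] by auto
  have "integral {0..v} ?f \<le> v powr (1 - \<alpha>) * ((v powr (\<alpha> - 1) - Gamma \<alpha> * h v) / y)"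
  proof (rule has_integral_le)
    \<comment> \<open>The open interval matters: at s = v the convention \<open>0 powr a = 0\<close>
      would make the right-hand side 0 and break the comparison.\<close>
    show "(?f has_integral integral {0..v} ?f) {0<..<v}"
      using integrable_integral[OF fi(1)] by (simp add: has_integral_Icc_iff_Ioo)
    show "((\<lambda>s. v powr (1 - \<alpha>) * ((v - s) powr (\<alpha> - 1) * h s)) has_integral
        v powr (1 - \<alpha>) * ((v powr (\<alpha> - 1) - Gamma \<alpha> * h v) / y)) {0<..<v}"
      using has_integral_mult_right[OF J[OF v01(1)]] by (simp add: has_integral_Icc_iff_Ioo)
    fix s assume s: "s \<in> {0<..<v}"
    \<comment> \<open>Since v s \<le> s, the quotient is at most v. The resulting kernel comparison
      bounds this part of the equation at 1 by the equation at \<open>v\<close>.\<close>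
    have "((v - s) / (1 - s)) powr (1 - \<alpha>) \<le> v powr (1 - \<alpha>)"
      using s v01 assms by (intro powr_mono2) (auto simp: field_simps)
    then have "(v - s) powr (1 - \<alpha>) \<le> v powr (1 - \<alpha>) * (1 - s) powr (1 - \<alpha>)"
      using s v01 by (simp add: powr_divide field_simps)
    moreover have "B \<le> c * A \<Longrightarrow> 0 < A \<Longrightarrow> 0 < B \<Longrightarrow> 1 / A \<le> c * (1 / B)" for A B c :: real
      by (simp add: field_simps)
    moreover have "r powr (\<alpha> - 1) = 1 / r powr (1 - \<alpha>)" for r :: real
      using powr_minus_divide[of r "1 - \<alpha>"] by simp
    ultimately have "(1 - s) powr (\<alpha> - 1) \<le> v powr (1 - \<alpha>) * (v - s) powr (\<alpha> - 1)"
      using s v01 by simp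
    then show "?f s \<le> v powr (1 - \<alpha>) * ((v - s) powr (\<alpha> - 1) * h s)"
      using hpos[of s] s v01 by (simp add: mult.assoc[symmetric] mult_right_mono)
  qed
  \<comment> \<open>Here \<open>h\<close> is bounded by its maximum \<open>h v\<close> and the
    kernel is integrated explicitly.\<close>
  moreover have "integral {v..1} ?f \<le> h v * ((1 - v) powr \<alpha> / \<alpha>)"
  proof (rule has_integral_le)
    show "(?f has_integral integral {v..1} ?f) {v..1}"
      using integrable_integral[OF fi(2)] .
    have "((\<lambda>x. x powr (\<alpha> - 1)) has_integral ((1 - v) powr \<alpha> / \<alpha>)) (cbox 0 (1 - v))"
      using has_integral_powr_from_0[of "\<alpha> - 1" "1 - v"] assms v01 by simp
    from has_integral_affinity[OF this, of "-1" 1]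
    have "((\<lambda>s. (1 - s) powr (\<alpha> - 1)) has_integral ((1 - v) powr \<alpha> / \<alpha>)) {v..1}"
      using v01 by simp
    then show "((\<lambda>s. h v * (1 - s) powr (\<alpha> - 1)) has_integral h v * ((1 - v) powr \<alpha> / \<alpha>)) {v..1}"
      by (rule has_integral_mult_right)
    show "?f s \<le> h v * (1 - s) powr (\<alpha> - 1)" if "s \<in> {v..1}" for s
      using v(2)[of s] v(1) that by (simp add: mult.commute mult_right_mono)
  qed
  ultimately have "(1 - Gamma \<alpha> * h 1) / y \<le>
      v powr (1 - \<alpha>) * ((v powr (\<alpha> - 1) - Gamma \<alpha> * h v) / y) + h v * ((1 - v) powr \<alpha> / \<alpha>)"
    using tot by linarith
  moreover have "A / y \<le> B * (C / y) + D \<Longrightarrow> A \<le> B * C + y * D" for A B C D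
    using y by (simp add: field_simps)
  ultimately have "1 - Gamma \<alpha> * h 1 \<le>
      v powr (1 - \<alpha>) * (v powr (\<alpha> - 1) - Gamma \<alpha> * h v) + y * (h v * ((1 - v) powr \<alpha> / \<alpha>))"
    by blast
  also have "\<dots> = 1 - h v * (Gamma \<alpha> * v powr (1 - \<alpha>) - y * (1 - v) powr \<alpha> / \<alpha>)"
  proof -
    have "v powr (1 - \<alpha>) * v powr (\<alpha> - 1) = 1" using v01 by (simp add: powr_add[symmetric])
    then show ?thesis by (simp add: algebra_simps)
  qed
  also have "\<dots> < 1"
    using b(2)[OF v01(3,2)] hpos[OF v01(1,2)] by simp
  \<comment> \<open>The chain gives 1 - Gamma \<alpha> h(1) < 1, so \<open>h 1\<close> would be
    positive.\<close>
  finally show False using h1 G by (simp add: mult_less_0_iff zero_less_mult_iff not_less)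
qed

subsection \<open>Strict convexity and monotonicity\<close>

text \<open>Cauchy products multiply generating functions: the constant 1 belongs to 1 / (1 - x),
  its convolution square to 1 / (1 - x)^2, and its cube, treated next, to 1 / (1 - x)^3.\<close>

lemma cauchy_prod_one: "cauchy_prod (\<lambda>_. 1) (\<lambda>_. 1) = (\<lambda>n. real (Suc n))"
  by (simp add: cauchy_prod_def fun_eq_iff)

lemma cauchy_prod_Suc: "cauchy_prod (\<lambda>n. real (Suc n)) (\<lambda>_. 1) = (\<lambda>n. real (Suc n) * real (Suc (Suc n)) / 2)"
proof
  show "cauchy_prod (\<lambda>n. real (Suc n)) (\<lambda>_. 1) n = real (Suc n) * real (Suc (Suc n)) / 2" for n
    by (induction n) (auto simp: cauchy_prod_def field_simps)
qed

text \<open>These are the coefficients of the first derivative. Two factors with parameter \<alpha>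
  give 2 \<alpha>, and a constant with parameter \<beta> - \<alpha> > 0 lifts this to \<beta> +
  \<alpha>. For x > 0 every term is positive.\<close>

lemma ml_series_first_derivative_pos:
  fixes \<alpha> \<beta> x :: real
  assumes "0 < \<alpha>" "\<alpha> \<le> 1" "\<alpha> < \<beta>"
  shows "ml_entire (\<lambda>n. real (Suc n)) \<alpha> (\<beta> + \<alpha>)" "0 < ml_series (\<lambda>n. real (Suc n)) \<alpha> (\<beta> + \<alpha>) x"
proof -
  note e1 = ml_entire_one[OF assms(1,1)]
  note e2 = ml_entire_cauchy_prod[OF assms(1,1,1) e1 e1, unfolded cauchy_prod_one]
  have p: "0 < \<alpha> + \<alpha>" "0 < \<beta> - \<alpha>" using assms by auto
  have b: "\<alpha> + \<alpha> + (\<beta> - \<alpha>) = \<beta> + \<alpha>" by simp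
  note e3 = ml_entire_cauchy_prod[OF assms(1) p e2 ml_entire_delta[of 1], unfolded cauchy_prod_delta mult_1_right b]
  show "ml_entire (\<lambda>n. real (Suc n)) \<alpha> (\<beta> + \<alpha>)" by (fact e3)
  have m2: "0 < ml_series (\<lambda>n. real (Suc n)) \<alpha> (\<alpha> + \<alpha>) x" if "x \<le> 0" for x
    using ml_series_pos_cauchy_prod[OF assms(1,1,1) e1 e1 ml_series_one_pos_left[OF assms(1,2)] ml_series_one_pos_left[OF assms(1,2)] that]
    by (simp only: cauchy_prod_one)
  have d: "0 < ml_series (\<lambda>n. if n = 0 then 1 else 0) \<alpha> (\<beta> - \<alpha>) x" for x
    using p by (simp add: ml_series_delta Gamma_real_pos)
  show "0 < ml_series (\<lambda>n. real (Suc n)) \<alpha> (\<beta> + \<alpha>) x"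
  proof (cases "x \<le> 0")
    case True
    from ml_series_pos_cauchy_prod[OF assms(1) p e2 ml_entire_delta[of 1] m2 d this]
    show ?thesis by (simp only: cauchy_prod_delta mult_1_right b)
  next
    case False
    then show ?thesis using assms e3 by (intro ml_series_pos_right) auto
  qed
qed

text \<open>Now three factors with parameter \<alpha> are convolved. The constant has coefficient 2,
  which cancels the denominator in \<open>cauchy_prod_Suc\<close>.\<close>

lemma ml_series_second_derivative_pos:
  fixes \<alpha> \<beta> x :: real
  assumes "0 < \<alpha>" "\<alpha> \<le> 1" "\<alpha> < \<beta>"
  shows "0 < ml_series (\<lambda>n. real (Suc n) * real (Suc (Suc n))) \<alpha> (\<beta> + \<alpha> + \<alpha>) x"
proof -
  note e1 = ml_entire_one[OF assms(1,1)]
  note e2 = ml_entire_cauchy_prod[OF assms(1,1,1) e1 e1, unfolded cauchy_prod_one]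
  have p: "0 < \<alpha> + \<alpha>" "0 < \<alpha> + \<alpha> + \<alpha>" "0 < \<beta> - \<alpha>" using assms by auto
  have b: "\<alpha> + \<alpha> + \<alpha> + (\<beta> - \<alpha>) = \<beta> + \<alpha> + \<alpha>" by simp
  have c: "(\<lambda>n. real (Suc n) * real (Suc (Suc n)) / 2 * 2) = (\<lambda>n. real (Suc n) * real (Suc (Suc n)))"
    by (rule ext) simp
  note e3 = ml_entire_cauchy_prod[OF assms(1) p(1) assms(1) e2 e1, unfolded cauchy_prod_Suc]
  note e4 = ml_entire_cauchy_prod[OF assms(1) p(2,3) e3 ml_entire_delta[of 2], unfolded cauchy_prod_delta b c]
  have m2: "0 < ml_series (\<lambda>n. real (Suc n)) \<alpha> (\<alpha> + \<alpha>) x" if "x \<le> 0" for x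
    using ml_series_pos_cauchy_prod[OF assms(1,1,1) e1 e1 ml_series_one_pos_left[OF assms(1,2)] ml_series_one_pos_left[OF assms(1,2)] that]
    by (simp only: cauchy_prod_one)
  have m3: "0 < ml_series (\<lambda>n. real (Suc n) * real (Suc (Suc n)) / 2) \<alpha> (\<alpha> + \<alpha> + \<alpha>) x" if "x \<le> 0" for x
    using ml_series_pos_cauchy_prod[OF assms(1) p(1) assms(1) e2 e1 m2 ml_series_one_pos_left[OF assms(1,2)] that]
    by (simp only: cauchy_prod_Suc)
  have d: "0 < ml_series (\<lambda>n. if n = 0 then 2 else 0) \<alpha> (\<beta> - \<alpha>) x" for x
    using p by (simp add: ml_series_delta Gamma_real_pos)
  show ?thesis
  proof (cases "x \<le> 0")
    case True
    from ml_series_pos_cauchy_prod[OF assms(1) p(2,3) e3 ml_entire_delta[of 2] m3 d this]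
    show ?thesis by (simp only: cauchy_prod_delta b c)
  next
    case False
    then show ?thesis using assms e4 by (intro ml_series_pos_right) auto
  qed
qed

text \<open>The derivative is strictly increasing, so the mean value theorem on either side of
  \<open>c\<close> gives a strict inequality.\<close>

lemma strict_tangent_bound:
  fixes f f' f'' :: "real \<Rightarrow> real"
  assumes f': "\<And>x. (f has_real_derivative f' x) (at x)"
    and f'': "\<And>x. (f' has_real_derivative f'' x) (at x)"
    and pos: "\<And>x. 0 < f'' x" and "y \<noteq> c"
  shows "f c + f' c * (y - c) < f y"
proof -
  have mono: "f' s < f' t" if "s < t" for s t
    using that f'' pos by (intro DERIV_pos_imp_increasing[of s t f']) blast+
  show ?thesis
  proof (cases "c < y")
    case True
    then obtain z where z: "c < z" "f y - f c = (y - c) * f' z"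
      using MVT2[of c y f f'] f' by blast
    have "(y - c) * f' c < (y - c) * f' z"
      using True mono[OF z(1)] by (intro mult_strict_left_mono) auto
    with z(2) show ?thesis by (simp add: algebra_simps)
  next
    case False
    then have "y < c" using assms(4) by simp
    then obtain z where z: "z < c" "f c - f y = (c - y) * f' z"
      using MVT2[of y c f f'] f' by blast
    have "(c - y) * f' z < (c - y) * f' c"
      using \<open>y < c\<close> mono[OF z(1)] by (intro mult_strict_left_mono) auto
    with z(2) show ?thesis by (simp add: algebra_simps)
  qed
qed

section \<open>Strict monotonicity in \<beta> by Jensen's inequality\<close>

definition normalized_ml :: "real \<Rightarrow> real \<Rightarrow> real \<Rightarrow> real" where
  "normalized_ml \<alpha> \<beta> x = Gamma \<beta> * mittag_leffler \<alpha> \<beta> (Gamma (\<beta> + \<alpha>) / Gamma \<beta> * x)"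

lemma mittag_leffler_eq_ml_series: "mittag_leffler \<alpha> \<beta> = ml_series (\<lambda>_. 1) \<alpha> \<beta>"
  by (simp add: fun_eq_iff mittag_leffler_def ml_series_def)

lemma mittag_leffler_derivatives:
  assumes "0 < \<alpha>" "\<alpha> \<le> 1" "\<alpha> < \<beta>"
  shows "(mittag_leffler \<alpha> \<beta> has_real_derivative ml_series (\<lambda>n. real (Suc n)) \<alpha> (\<beta> + \<alpha>) x) (at x)"
    and "(ml_series (\<lambda>n. real (Suc n)) \<alpha> (\<beta> + \<alpha>) has_real_derivative
          ml_series (\<lambda>n. real (Suc n) * real (Suc (Suc n))) \<alpha> (\<beta> + \<alpha> + \<alpha>) x) (at x)"
proof -
  have "0 < \<beta>" using assms by simp
  from ml_series_has_derivative[OF ml_entire_one[OF assms(1) this], of x]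
  show "(mittag_leffler \<alpha> \<beta> has_real_derivative ml_series (\<lambda>n. real (Suc n)) \<alpha> (\<beta> + \<alpha>) x) (at x)"
    by (simp only: mittag_leffler_eq_ml_series mult_1_right)
  show "(ml_series (\<lambda>n. real (Suc n)) \<alpha> (\<beta> + \<alpha>) has_real_derivative
          ml_series (\<lambda>n. real (Suc n) * real (Suc (Suc n))) \<alpha> (\<beta> + \<alpha> + \<alpha>) x) (at x)"
    by (rule ml_series_has_derivative[OF ml_series_first_derivative_pos(1)[OF assms]])
qed

lemma normalized_ml_strict_mono:
  fixes \<alpha> \<beta> \<gamma> x :: real
  assumes "0 < \<alpha>" "\<alpha> \<le> 1" "\<alpha> < \<beta>" "\<beta> < \<gamma>" "x \<noteq> 0"
  shows "normalized_ml \<alpha> \<beta> x < normalized_ml \<alpha> \<gamma> x"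
proof -
  define E where "E = mittag_leffler \<alpha>"
  define D where "D = ml_series (\<lambda>n. real (Suc n)) \<alpha> (\<beta> + \<alpha>)"
  define q where "q = \<gamma> - \<beta>"
  define z where "z = Gamma (\<gamma> + \<alpha>) / Gamma \<gamma> * x"
  define c where "c = Gamma (\<beta> + \<alpha>) / Gamma \<beta> * x"
  have pos: "0 < \<beta>" "0 < q" "0 < \<beta> + \<alpha>" "0 < \<gamma>" "0 < \<gamma> + \<alpha>" using assms by (auto simp: q_def)
  have G: "0 < Gamma \<beta>" "0 < Gamma q" "0 < Gamma (\<beta> + \<alpha>)" "0 < Gamma \<gamma>" "0 < Gamma (\<gamma> + \<alpha>)"
    using pos by (auto intro: Gamma_real_pos)
  have z: "z \<noteq> 0" using G[THEN less_imp_neq, THEN not_sym] assms(5) by (simp add: z_def)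
  let ?w = "\<lambda>u::real. u powr (\<beta> - 1) * (1 - u) powr (q - 1)"
  let ?w' = "\<lambda>u::real. u powr (\<beta> + \<alpha> - 1) * (1 - u) powr (q - 1)"
  have wint: "set_integrable lborel {0<..<1} (\<lambda>u. u powr (s - 1) * (1 - u) powr (q - 1))"
    and wval: "(LINT u:{0<..<1}|lborel. u powr (s - 1) * (1 - u) powr (q - 1)) = Beta s q" if "0 < s" for s
  proof -
    show i: "set_integrable lborel {0<..<1} (\<lambda>u. u powr (s - 1) * (1 - u) powr (q - 1))"
      by (rule set_integrable_subset[OF integrable_Beta[OF that pos(2)]]) auto
    show "(LINT u:{0<..<1}|lborel. u powr (s - 1) * (1 - u) powr (q - 1)) = Beta s q"
      using set_borel_integral_eq_integral(2)[OF i] has_integral_Beta_real[OF that pos(2)]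
      by (simp add: has_integral_Icc_iff_Ioo integral_unique)
  qed
  note mix = ml_series_mixture[OF assms(1) pos(1,2) ml_entire_one[OF assms(1) pos(1)], of z,
      folded mittag_leffler_eq_ml_series E_def]
  \<comment> \<open>The weight times the distance of \<open>E \<beta>\<close> from its tangent at
    \<open>c\<close>; the linear part of the tangent is collected in \<open>?w'\<close>, which is
    \<open>?w\<close> times \<open>u powr \<alpha>\<close>.\<close>
  let ?gap = "\<lambda>u. ?w u * E \<beta> (z * u powr \<alpha>) - ((E \<beta> c - D c * c) * ?w u + (D c * z) * ?w' u)"
  have i2: "set_integrable lborel {0<..<1} (\<lambda>u. (E \<beta> c - D c * c) * ?w u + (D c * z) * ?w' u)"
    by (intro set_integral_add(1) set_integrable_mult_right wint pos)
  have "0 < (LINT u:{0<..<1}|lborel. ?gap u)"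
  \<comment> \<open>This is the only \<open>u\<close> that can satisfy
    \<open>z * u powr \<alpha> = c\<close>, where the tangent touches.\<close>
  proof (rule set_integral_pos_Ioo[where v = "(c / z) powr (1 / \<alpha>)"])
    show "set_integrable lborel {0<..<1} ?gap"
      by (intro set_integral_diff(1) mix(1) i2)
    fix u :: real assume u: "u \<in> {0<..<1}" "u \<noteq> (c / z) powr (1 / \<alpha>)"
    have "z * u powr \<alpha> \<noteq> c"
    proof
      assume "z * u powr \<alpha> = c"
      then have "c / z = u powr \<alpha>" using z by auto
      then have "(c / z) powr (1 / \<alpha>) = u" using u assms by (simp add: powr_powr)
      with u show False by simp
    qed
    then have "E \<beta> c + D c * (z * u powr \<alpha> - c) < E \<beta> (z * u powr \<alpha>)"
      unfolding E_def D_def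
      by (intro strict_tangent_bound[OF mittag_leffler_derivatives[OF assms(1-3)]]
          ml_series_second_derivative_pos[OF assms(1-3)])
    moreover have "0 < ?w u" using u by simp
    ultimately have "?w u * (E \<beta> c + D c * (z * u powr \<alpha> - c)) < ?w u * E \<beta> (z * u powr \<alpha>)"
      by (rule mult_strict_left_mono)
    moreover have w': "?w' u = ?w u * u powr \<alpha>"
      by (simp add: powr_add[symmetric] algebra_simps)
    ultimately show "0 < ?gap u" unfolding w' by (simp add: algebra_simps)
  qed
  also have "(LINT u:{0<..<1}|lborel. ?gap u) =
      Gamma q * E \<gamma> z - ((E \<beta> c - D c * c) * Beta \<beta> q + (D c * z) * Beta (\<beta> + \<alpha>) q)"
  proof -
    have bg: "\<beta> + q = \<gamma>" by (simp add: q_def)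
    have "(LINT u:{0<..<1}|lborel. (E \<beta> c - D c * c) * ?w u + (D c * z) * ?w' u) =
      (E \<beta> c - D c * c) * Beta \<beta> q + (D c * z) * Beta (\<beta> + \<alpha>) q"
      by (subst set_integral_add(2)) (auto intro!: set_integrable_mult_right wint pos simp: wval pos)
    then show ?thesis
      by (subst set_integral_diff(2)[OF mix(1) i2]) (simp add: mix(2) bg)
  qed
  also have "(E \<beta> c - D c * c) * Beta \<beta> q + (D c * z) * Beta (\<beta> + \<alpha>) q = E \<beta> c * Beta \<beta> q"
  proof -
    have e: "\<beta> + \<alpha> + q = \<gamma> + \<alpha>" "\<beta> + q = \<gamma>" by (auto simp: q_def)
    \<comment> \<open>The mean of \<open>z * u powr \<alpha>\<close> is \<open>c\<close>, so the
      linear part of the tangent integrates to zero.\<close>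
    have "z * Beta (\<beta> + \<alpha>) q = c * Beta \<beta> q"
      unfolding z_def c_def Beta_def e using G[THEN less_imp_neq, THEN not_sym] by simp
    then show ?thesis by (simp add: algebra_simps)
  qed
  also have "E \<beta> c * Beta \<beta> q = Gamma q * (Gamma \<beta> * E \<beta> c / Gamma \<gamma>)"
    by (simp add: Beta_def q_def)
  finally have "Gamma q * (Gamma \<beta> * E \<beta> c / Gamma \<gamma>) < Gamma q * E \<gamma> z"
    by (simp only: diff_gt_0_iff_gt)
  then have "Gamma \<beta> * E \<beta> c / Gamma \<gamma> < E \<gamma> z"
    using G(2) by (simp only: mult_less_cancel_left_pos)
  then have "Gamma \<beta> * E \<beta> c < Gamma \<gamma> * E \<gamma> z"
    using G(4) by (simp only: pos_divide_less_eq mult.commute)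
  then show ?thesis by (simp add: normalized_ml_def E_def c_def z_def)
qed

subsection \<open>Limits\<close>

text \<open>The \<rho> of the recursion: the quotient of the scaling factors at \<beta> and at
  \<beta> + \<alpha>.\<close>

definition gamma_ratio :: "real \<Rightarrow> real \<Rightarrow> real" where
  "gamma_ratio \<alpha> \<beta> = (Gamma (\<beta> + \<alpha>) / Gamma \<beta>) / (Gamma (\<beta> + \<alpha> + \<alpha>) / Gamma (\<beta> + \<alpha>))"

text \<open>The upper bound is monotonicity of the scaling factor. For the lower one, \<alpha> \<le>
  1 allows comparison with the factor at \<beta> + 1, which the functional equation makes
  explicit.\<close>

lemma gamma_ratio_bounds:
  assumes "0 < \<alpha>" "\<alpha> \<le> 1" "0 < \<beta>"
  shows "0 < gamma_ratio \<alpha> \<beta>" "gamma_ratio \<alpha> \<beta> \<le> 1" "\<beta> / (\<beta> + \<alpha>) \<le> gamma_ratio \<alpha> \<beta>"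
proof -
  define r where "r = (\<lambda>\<beta>. Gamma (\<beta> + \<alpha>) / Gamma \<beta>)"
  have r: "0 < r \<beta>" if "0 < \<beta>" for \<beta>
    using that assms by (auto simp: r_def intro!: divide_pos_pos Gamma_real_pos)
  have mono: "r s \<le> r t" if "0 < s" "s \<le> t" for s t
    using Gamma_ratio_mono[OF assms(1) that] by (simp add: r_def)
  have eq: "gamma_ratio \<alpha> \<beta> = r \<beta> / r (\<beta> + \<alpha>)" by (simp add: gamma_ratio_def r_def)
  have pos: "0 < r \<beta>" "0 < r (\<beta> + \<alpha>)" using r assms by auto
  show "0 < gamma_ratio \<alpha> \<beta>" unfolding eq using pos by simp
  show "gamma_ratio \<alpha> \<beta> \<le> 1" unfolding eq using pos mono[of \<beta> "\<beta> + \<alpha>"] assms by simp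
  have "\<beta> \<notin> \<int>\<^sub>\<le>\<^sub>0" "\<beta> + \<alpha> \<notin> \<int>\<^sub>\<le>\<^sub>0" using assms by (auto elim!: nonpos_Ints_cases')
  then have "Gamma (\<beta> + 1) = \<beta> * Gamma \<beta>" "Gamma (\<beta> + 1 + \<alpha>) = (\<beta> + \<alpha>) * Gamma (\<beta> + \<alpha>)"
    using Gamma_plus1[of \<beta>] Gamma_plus1[of "\<beta> + \<alpha>"] by (simp_all add: algebra_simps)
  then have "r (\<beta> + 1) = (\<beta> + \<alpha>) / \<beta> * r \<beta>" using assms by (simp add: r_def)
  moreover have "r (\<beta> + \<alpha>) \<le> r (\<beta> + 1)" using assms by (intro mono) auto
  ultimately have "r (\<beta> + \<alpha>) \<le> (\<beta> + \<alpha>) / \<beta> * r \<beta>" by simp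
  then show "\<beta> / (\<beta> + \<alpha>) \<le> gamma_ratio \<alpha> \<beta>"
    unfolding eq using pos assms by (simp add: field_simps)
qed

lemma gamma_ratio_tendsto:
  assumes "0 < \<alpha>" "\<alpha> \<le> 1"
  shows "(gamma_ratio \<alpha> \<longlongrightarrow> 1) at_top"
proof (rule tendsto_sandwich)
  show "((\<lambda>\<beta>. \<beta> / (\<beta> + \<alpha>)) \<longlongrightarrow> 1) at_top" by real_asymp
  show "\<forall>\<^sub>F \<beta> in at_top. \<beta> / (\<beta> + \<alpha>) \<le> gamma_ratio \<alpha> \<beta>"
    "\<forall>\<^sub>F \<beta> in at_top. gamma_ratio \<alpha> \<beta> \<le> 1"
    using eventually_gt_at_top[of 0] by (eventually_elim; use gamma_ratio_bounds[OF assms] in blast)+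
qed simp

section \<open>Power series coefficients and the limit for x > 0\<close>

text \<open>The coefficient of the unscaled x^n: the scaling factor is absorbed, so that a termwise
  limit in \<beta> exists.\<close>

definition ml_coeff :: "real \<Rightarrow> nat \<Rightarrow> real \<Rightarrow> real" where
  "ml_coeff \<alpha> n \<beta> = Gamma \<beta> / Gamma (\<beta> + \<alpha> * real n) * (Gamma (\<beta> + \<alpha>) / Gamma \<beta>) ^ n"

lemma normalized_ml_sums:
  assumes "0 < \<alpha>" "0 < \<beta>"
  shows "(\<lambda>n. ml_coeff \<alpha> n \<beta> * x ^ n) sums normalized_ml \<alpha> \<beta> x"
proof -
  let ?z = "Gamma (\<beta> + \<alpha>) / Gamma \<beta> * x"
  have "(\<lambda>n. ?z ^ n / Gamma (\<beta> + \<alpha> * real n)) sums mittag_leffler \<alpha> \<beta> ?z"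
    using ml_entire_one[OF assms] unfolding mittag_leffler_def ml_entire_def
    by (intro summable_sums) (auto dest: spec[of _ ?z])
  from sums_mult[OF this, of "Gamma \<beta>"] show ?thesis
    unfolding normalized_ml_def ml_coeff_def power_mult_distrib by (simp add: mult_ac)
qed

text \<open>Lowering the degree moves \<beta> to \<beta> + \<alpha> at the cost of powers of \<rho>;
  the bound by 1 and the limit 1 both follow by induction along this identity.\<close>

lemma ml_coeff_Suc:
  assumes "0 < \<alpha>" "0 < \<beta>"
  shows "ml_coeff \<alpha> (Suc n) \<beta> = gamma_ratio \<alpha> \<beta> ^ n * ml_coeff \<alpha> n (\<beta> + \<alpha>)"
proof -
  define r s where "r = Gamma (\<beta> + \<alpha>) / Gamma \<beta>" and "s = Gamma (\<beta> + \<alpha> + \<alpha>) / Gamma (\<beta> + \<alpha>)"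
  have "0 < Gamma \<beta>" "0 < s"
    unfolding s_def using assms by (auto intro!: divide_pos_pos Gamma_real_pos)
  then have r: "(r / s) ^ n * (c * s ^ n) = c * r ^ n" "Gamma (\<beta> + \<alpha>) = Gamma \<beta> * r" for c
    by (simp_all add: power_divide) (simp add: r_def)
  have e: "\<beta> + \<alpha> * real (Suc n) = \<beta> + \<alpha> + \<alpha> * real n" by (simp add: algebra_simps)
  have "(r / s) ^ n * (Gamma (\<beta> + \<alpha>) / G * s ^ n) = Gamma \<beta> / G * r ^ Suc n" for G
    by (subst r(1)) (simp add: r(2))
  then show ?thesis
    by (simp only: ml_coeff_def gamma_ratio_def e r_def[symmetric] s_def[symmetric])
qed

lemma ml_coeff_nonneg: "0 < \<alpha> \<Longrightarrow> 0 < \<beta> \<Longrightarrow> 0 \<le> ml_coeff \<alpha> n \<beta>"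
  by (auto simp: ml_coeff_def intro!: mult_nonneg_nonneg divide_nonneg_nonneg
      zero_le_power less_imp_le[OF Gamma_real_pos] add_pos_nonneg)

lemma ml_coeff_zero: "0 < \<beta> \<Longrightarrow> ml_coeff \<alpha> 0 \<beta> = 1"
  using Gamma_real_pos[of \<beta>] by (simp add: ml_coeff_def less_imp_neq[symmetric])

lemma ml_coeff_le_1:
  assumes "0 < \<alpha>" "\<alpha> \<le> 1" "0 < \<beta>"
  shows "ml_coeff \<alpha> n \<beta> \<le> 1"
  using assms(3)
proof (induction n arbitrary: \<beta>)
  case (Suc n)
  have "gamma_ratio \<alpha> \<beta> ^ n \<le> 1"
    using gamma_ratio_bounds[OF assms(1,2) Suc.prems] by (intro power_le_one) auto
  then show ?case
    using Suc assms ml_coeff_nonneg[of \<alpha> "\<beta> + \<alpha>" n] gamma_ratio_bounds[OF assms(1,2) Suc.prems]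
    by (subst ml_coeff_Suc) (auto intro!: mult_le_one)
qed (simp add: ml_coeff_zero)

lemma ml_coeff_tendsto:
  assumes "0 < \<alpha>" "\<alpha> \<le> 1"
  shows "(ml_coeff \<alpha> n \<longlongrightarrow> 1) at_top"
proof (induction n)
  case 0
  show ?case
    by (rule tendsto_eventually)
       (use eventually_gt_at_top[of 0] in eventually_elim, rule ml_coeff_zero)
next
  case (Suc n)
  have "filterlim (\<lambda>\<beta>. \<beta> + \<alpha>) at_top at_top" by real_asymp
  from filterlim_compose[OF Suc this]
  have "((\<lambda>\<beta>. gamma_ratio \<alpha> \<beta> ^ n * ml_coeff \<alpha> n (\<beta> + \<alpha>)) \<longlongrightarrow> 1 ^ n * 1) at_top"
    by (intro tendsto_intros gamma_ratio_tendsto assms)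
  moreover have "\<forall>\<^sub>F \<beta> in at_top. gamma_ratio \<alpha> \<beta> ^ n * ml_coeff \<alpha> n (\<beta> + \<alpha>) = ml_coeff \<alpha> (Suc n) \<beta>"
    using eventually_gt_at_top[of 0] by eventually_elim (use assms in \<open>simp add: ml_coeff_Suc\<close>)
  ultimately show ?case by (simp add: tendsto_cong)
qed

text \<open>For x \<ge> 0 all terms are nonnegative, so the full sum dominates each partial sum,
  whose limit in \<beta> is a finite geometric sum.\<close>

lemma normalized_ml_eventually_gt:
  assumes "0 < \<alpha>" "\<alpha> \<le> 1" "0 \<le> x" "a < (\<Sum>n<N. x ^ n)"
  shows "\<forall>\<^sub>F \<beta> in at_top. a < normalized_ml \<alpha> \<beta> x"
proof -
  have "((\<lambda>\<beta>. \<Sum>n<N. ml_coeff \<alpha> n \<beta> * x ^ n) \<longlongrightarrow> (\<Sum>n<N. 1 * x ^ n)) at_top"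
    by (intro tendsto_intros ml_coeff_tendsto assms)
  then have "\<forall>\<^sub>F \<beta> in at_top. a < (\<Sum>n<N. ml_coeff \<alpha> n \<beta> * x ^ n)"
    using assms by (intro order_tendstoD(1)) auto
  then show ?thesis
    using eventually_gt_at_top[of 0]
  proof eventually_elim
    case (elim \<beta>)
    have "(\<Sum>n<N. ml_coeff \<alpha> n \<beta> * x ^ n) \<le> normalized_ml \<alpha> \<beta> x"
      using normalized_ml_sums[OF assms(1) elim(2), of x] ml_coeff_nonneg[OF assms(1) elim(2)] assms(3)
      sum_le_suminf[of "\<lambda>n. ml_coeff \<alpha> n \<beta> * x ^ n" "{..<N}"]
      by (simp add: sums_iff)
    with elim show ?case by simp
  qed
qed

lemma normalized_ml_at_top:
  assumes "0 < \<alpha>" "\<alpha> \<le> 1" "1 \<le> x"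
  shows "filterlim (\<lambda>\<beta>. normalized_ml \<alpha> \<beta> x) at_top at_top"
  unfolding filterlim_at_top_dense
proof
  fix Z :: real
  obtain N where "Z < real N" using reals_Archimedean2 by blast
  also have "real N = (\<Sum>n<N. 1)" by simp
  also have "\<dots> \<le> (\<Sum>n<N. x ^ n)" using assms by (intro sum_mono one_le_power)
  finally show "\<forall>\<^sub>F \<beta> in at_top. Z < normalized_ml \<alpha> \<beta> x"
    using assms by (intro normalized_ml_eventually_gt) auto
qed

lemma normalized_ml_tendsto_pos:
  assumes "0 < \<alpha>" "\<alpha> \<le> 1" "0 < x" "x < 1"
  shows "((\<lambda>\<beta>. normalized_ml \<alpha> \<beta> x) \<longlongrightarrow> 1 / (1 - x)) at_top"
proof (rule order_tendstoI)
  have geo: "(\<lambda>n. x ^ n) sums (1 / (1 - x))" using assms by (intro geometric_sums) auto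
  show "\<forall>\<^sub>F \<beta> in at_top. a < normalized_ml \<alpha> \<beta> x" if a: "a < 1 / (1 - x)" for a
  proof -
    have "eventually (\<lambda>N. a < (\<Sum>n<N. x ^ n)) sequentially"
      using geo a unfolding sums_def by (intro order_tendstoD(1))
    then obtain N where "a < (\<Sum>n<N. x ^ n)" by (auto simp: eventually_sequentially)
    then show ?thesis using assms by (intro normalized_ml_eventually_gt) auto
  qed
  \<comment> \<open>All coefficients are at most 1, so the geometric series is an upper bound for
    every positive \<beta>.\<close>
  show "\<forall>\<^sub>F \<beta> in at_top. normalized_ml \<alpha> \<beta> x < a" if a: "1 / (1 - x) < a" for a
    using eventually_gt_at_top[of 0]
  proof eventually_elim
    case (elim \<beta>)
    have "normalized_ml \<alpha> \<beta> x \<le> 1 / (1 - x)"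
      by (rule sums_le[OF _ normalized_ml_sums[OF assms(1) elim] geo])
         (use ml_coeff_le_1[OF assms(1,2) elim] assms in \<open>auto intro!: mult_left_le_one_le ml_coeff_nonneg elim\<close>)
    with a show ?case by simp
  qed
qed

section \<open>Recursion in \<beta> and the limit for x < 0\<close>

lemma normalized_ml_recursion:
  assumes "0 < \<alpha>" "0 < \<beta>"
  shows "normalized_ml \<alpha> \<beta> x = 1 + x * normalized_ml \<alpha> (\<beta> + \<alpha>) (gamma_ratio \<alpha> \<beta> * x)"
proof -
  have "0 < Gamma \<beta>" "0 < Gamma (\<beta> + \<alpha>)" "0 < Gamma (\<beta> + \<alpha> + \<alpha>)"
    using assms by (auto intro!: Gamma_real_pos)
  then show ?thesis
    using ml_series_one_shift[OF assms, of "Gamma (\<beta> + \<alpha>) / Gamma \<beta> * x"]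
    by (simp add: normalized_ml_def mittag_leffler_eq_ml_series gamma_ratio_def field_simps)
qed

text \<open>Serves to remove \<rho> from the argument in the recursion. The first bound holds
  because \<open>E\<close> increases, the second by convexity between 0 and \<open>z\<close>, with
  \<open>Gamma \<beta> * E 0 = 1\<close>.\<close>

lemma normalized_ml_scaled_bounds:
  assumes "0 < \<alpha>" "\<alpha> \<le> 1" "\<alpha> < \<beta>" "x \<le> 0" "0 \<le> t" "t \<le> 1"
  shows "normalized_ml \<alpha> \<beta> x \<le> normalized_ml \<alpha> \<beta> (t * x)"
    and "normalized_ml \<alpha> \<beta> (t * x) \<le> t * normalized_ml \<alpha> \<beta> x + (1 - t)"
proof -
  define E where "E = mittag_leffler \<alpha> \<beta>"
  define z where "z = Gamma (\<beta> + \<alpha>) / Gamma \<beta> * x"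
  have G: "0 < Gamma \<beta>" "0 < Gamma (\<beta> + \<alpha>)" using assms by (auto intro!: Gamma_real_pos)
  have n: "normalized_ml \<alpha> \<beta> (s * x) = Gamma \<beta> * E (s * z)" for s
    by (simp add: normalized_ml_def E_def z_def mult_ac)
  have "z \<le> 0" unfolding z_def using assms G by (intro mult_nonneg_nonpos divide_nonneg_nonneg) auto
  then have "z \<le> t * z" using mult_right_mono_neg[of t 1 z] assms by simp
  then have "E z \<le> E (t * z)"
  proof (rule DERIV_nonneg_imp_nondecreasing)
    show "\<exists>d. DERIV E s :> d \<and> 0 \<le> d" for s
      using mittag_leffler_derivatives(1)[OF assms(1-3), of s] ml_series_first_derivative_pos(2)[OF assms(1-3), of s]
      unfolding E_def by (intro exI[of _ "ml_series (\<lambda>n. real (Suc n)) \<alpha> (\<beta> + \<alpha>) s"]) simp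
  qed
  then show "normalized_ml \<alpha> \<beta> x \<le> normalized_ml \<alpha> \<beta> (t * x)"
    using n[of 1] n[of t] G by simp
  have "convex_on UNIV E"
    unfolding E_def
    by (rule f''_ge0_imp_convex[OF convex_UNIV mittag_leffler_derivatives[OF assms(1-3)]])
       (rule less_imp_le[OF ml_series_second_derivative_pos[OF assms(1-3)]])
  from convex_onD[OF this, of t 0 z] have "E (t * z) \<le> (1 - t) * E 0 + t * E z"
    using assms by simp
  then have "Gamma \<beta> * E (t * z) \<le> Gamma \<beta> * ((1 - t) * E 0 + t * E z)"
    using G by simp
  also have "\<dots> = (1 - t) * (Gamma \<beta> * E 0) + t * (Gamma \<beta> * E z)"
    by (simp add: algebra_simps)
  also have "Gamma \<beta> * E 0 = 1"
    using ml_series_one_shift[of \<alpha> \<beta> 0] assms G(1)[THEN less_imp_neq, THEN not_sym]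
    by (simp add: E_def mittag_leffler_eq_ml_series)
  finally show "normalized_ml \<alpha> \<beta> (t * x) \<le> t * normalized_ml \<alpha> \<beta> x + (1 - t)"
    using n[of 1] n[of t] by simp
qed

text \<open>The recursion links \<open>\<beta>\<close> and \<open>\<beta> + \<alpha>\<close>; monotonicity in \<open>\<beta>\<close> turns it into two-sided bounds,
  also for \<open>x \<le> - 1\<close>, where no termwise limit is available.\<close>
lemma normalized_ml_bounds_neg:
  assumes "0 < \<alpha>" "\<alpha> \<le> 1" "\<alpha> < \<beta>" "x < 0"
  shows "normalized_ml \<alpha> \<beta> x \<le> 1 / (1 - x)"
    and "(1 + x * (1 - gamma_ratio \<alpha> \<beta>)) / (1 - x * gamma_ratio \<alpha> \<beta>) \<le> normalized_ml \<alpha> (\<beta> + \<alpha>) x"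
proof -
  define f where "f = normalized_ml \<alpha> \<beta> x"
  define g where "g = normalized_ml \<alpha> (\<beta> + \<alpha>) x"
  define t where "t = gamma_ratio \<alpha> \<beta>"
  have t: "0 < t" "t \<le> 1" using gamma_ratio_bounds[of \<alpha> \<beta>] assms by (auto simp: t_def)
  have "f \<le> g" using normalized_ml_strict_mono[of \<alpha> \<beta> "\<beta> + \<alpha>" x] assms by (simp add: f_def g_def)
  have rec: "f = 1 + x * normalized_ml \<alpha> (\<beta> + \<alpha>) (t * x)"
    using normalized_ml_recursion[of \<alpha> \<beta> x] assms by (simp add: f_def t_def)
  have b: "g \<le> normalized_ml \<alpha> (\<beta> + \<alpha>) (t * x)"
    "normalized_ml \<alpha> (\<beta> + \<alpha>) (t * x) \<le> t * g + (1 - t)"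
    using normalized_ml_scaled_bounds[of \<alpha> "\<beta> + \<alpha>" x t] assms t by (auto simp: g_def)
  \<comment> \<open>Multiplication by x < 0 reverses the chain from \<open>f\<close> over
    \<open>g\<close> to the value at \<open>t * x\<close>.\<close>
  have "f \<le> 1 + x * f"
    unfolding rec using b(1) \<open>f \<le> g\<close> assms rec by (intro add_left_mono mult_left_mono_neg) auto
  then show "normalized_ml \<alpha> \<beta> x \<le> 1 / (1 - x)"
    using assms by (simp add: f_def[symmetric] field_simps)
  have "1 + x * (t * g + (1 - t)) \<le> f"
    unfolding rec using b(2) assms by (intro add_left_mono mult_left_mono_neg) auto
  then have "1 + x * (1 - t) \<le> g * (1 - x * t)"
    using \<open>f \<le> g\<close> by (simp add: algebra_simps)
  moreover have "0 < 1 - x * t" using assms t mult_neg_pos[of x t] by linarith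
  ultimately show "(1 + x * (1 - gamma_ratio \<alpha> \<beta>)) / (1 - x * gamma_ratio \<alpha> \<beta>) \<le> normalized_ml \<alpha> (\<beta> + \<alpha>) x"
    by (simp add: g_def[symmetric] t_def[symmetric] pos_divide_le_eq)
qed

lemma normalized_ml_tendsto_neg:
  assumes "0 < \<alpha>" "\<alpha> \<le> 1" "x < 0"
  shows "((\<lambda>\<beta>. normalized_ml \<alpha> \<beta> x) \<longlongrightarrow> 1 / (1 - x)) at_top"
proof (rule tendsto_sandwich)
  let ?l = "\<lambda>\<beta>. (1 + x * (1 - gamma_ratio \<alpha> \<beta>)) / (1 - x * gamma_ratio \<alpha> \<beta>)"
  have "(?l \<longlongrightarrow> (1 + x * (1 - 1)) / (1 - x * 1)) at_top"
    by (intro tendsto_intros gamma_ratio_tendsto assms) (use assms in auto)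
  moreover have "filterlim (\<lambda>\<beta>. \<beta> - \<alpha>) at_top at_top" by real_asymp
  ultimately have "((\<lambda>\<beta>. ?l (\<beta> - \<alpha>)) \<longlongrightarrow> (1 + x * (1 - 1)) / (1 - x * 1)) at_top"
    by (rule filterlim_compose)
  then show "((\<lambda>\<beta>. ?l (\<beta> - \<alpha>)) \<longlongrightarrow> 1 / (1 - x)) at_top" by simp
  show "\<forall>\<^sub>F \<beta> in at_top. ?l (\<beta> - \<alpha>) \<le> normalized_ml \<alpha> \<beta> x"
    \<comment> \<open>The lower bound is applied at \<beta> - \<alpha>, which has to exceed
      \<alpha>.\<close>
    using eventually_gt_at_top[of "2 * \<alpha>"]
  proof eventually_elim
    case (elim \<beta>)
    then show ?case using normalized_ml_bounds_neg(2)[of \<alpha> "\<beta> - \<alpha>" x] assms by simp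
  qed
  show "\<forall>\<^sub>F \<beta> in at_top. normalized_ml \<alpha> \<beta> x \<le> 1 / (1 - x)"
    using eventually_gt_at_top[of \<alpha>] by eventually_elim (use normalized_ml_bounds_neg(1) assms in blast)
qed simp

theorem theoremD:
  fixes \<alpha> x :: real
  assumes "0 < \<alpha>" and "\<alpha> \<le> 1" and "x \<noteq> 0"
  shows "strict_mono_on {\<alpha><..}
           (\<lambda>\<beta>. Gamma \<beta> * mittag_leffler \<alpha> \<beta> (Gamma (\<beta> + \<alpha>) / Gamma \<beta> * x))
    \<and> (x \<ge> 1 \<longrightarrow> filterlim
           (\<lambda>\<beta>. Gamma \<beta> * mittag_leffler \<alpha> \<beta> (Gamma (\<beta> + \<alpha>) / Gamma \<beta> * x)) at_top at_top)
    \<and> (x < 1 \<longrightarrow>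
           ((\<lambda>\<beta>. Gamma \<beta> * mittag_leffler \<alpha> \<beta> (Gamma (\<beta> + \<alpha>) / Gamma \<beta> * x))
             \<longlongrightarrow> 1 / (1 - x)) at_top)"
  unfolding normalized_ml_def[symmetric]
proof (intro conjI impI)
  show "strict_mono_on {\<alpha><..} (\<lambda>\<beta>. normalized_ml \<alpha> \<beta> x)"
    using assms by (auto intro!: strict_mono_onI normalized_ml_strict_mono)
  show "filterlim (\<lambda>\<beta>. normalized_ml \<alpha> \<beta> x) at_top at_top" if "1 \<le> x"
    using assms that by (intro normalized_ml_at_top)
  show "((\<lambda>\<beta>. normalized_ml \<alpha> \<beta> x) \<longlongrightarrow> 1 / (1 - x)) at_top" if "x < 1"
    using assms that normalized_ml_tendsto_neg[of \<alpha> x] normalized_ml_tendsto_pos[of \<alpha> x]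
    by (cases "x < 0") auto
qed

end
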